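(* For all $n \ge 1$, \[ \left| \mathcal{C}_{2n}(1243,2143) \right| = \left| \mathcal{C}_{2n+1}(1243,2143) \right| = q_n, \] where the sequence $q_n$ is defined by $q_1=2$, $q_2=7$ and $q_n = 4q_{n-1} - q_{n-2}$ for every $n \ge 3$.
   Context: $\mathfrak{S}_m$ is the set of permutations of $\{1,\ldots,m\}$. The reverse-complement of $\pi\in\mathfrak{S}_m$ is $\mathrm{rc}(\pi)=\pi'$ with $\pi'(i)=(m+1)-\pi(m+1-i)$ for $i=1,\ldots,m$; $\pi$ is centrosymmetric if $\mathrm{rc}(\pi)=\pi$. $\mathcal{C}_m(1243,2143)$ denotes the set of centrosymmetric permutations in $\mathfrak{S}_m$ that avoid both $1243$ and $2143$, i.e. contain no subsequence order-isomorphic to $1243$ or to $2143$. *)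

theory Defs
  imports "HOL-Combinatorics.Permutations" "HOL-Library.Sublist"
begin

text \<open>
  A permutation of \<open>{1..m}\<close> is a function \<^term>\<open>p :: nat \<Rightarrow> nat\<close> with \<^prop>\<open>p permutes {1..m}\<close>;
  it is the identity outside \<open>{1..m}\<close>, so equality of permutations is equality of functions.
\<close>

text \<open>The \<open>else\<close> branch makes the reverse-complement again a permutation in this sense.\<close>

definition reverse_complement :: "nat \<Rightarrow> (nat \<Rightarrow> nat) \<Rightarrow> nat \<Rightarrow> nat" where
  "reverse_complement m p = (\<lambda>i. if i \<in> {1..m} then (m + 1) - p (m + 1 - i) else i)"

definition centrosymmetric :: "nat \<Rightarrow> (nat \<Rightarrow> nat) \<Rightarrow> bool" where
  "centrosymmetric m p \<longleftrightarrow> reverse_complement m p = p"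

definition one_line :: "nat \<Rightarrow> (nat \<Rightarrow> nat) \<Rightarrow> nat list" where
  "one_line m p = map p [1..<m + 1]"

definition order_isomorphic :: "nat list \<Rightarrow> nat list \<Rightarrow> bool" where
  "order_isomorphic xs ys \<longleftrightarrow>
     length xs = length ys \<and>
     (\<forall>i<length xs. \<forall>j<length xs. xs ! i < xs ! j \<longleftrightarrow> ys ! i < ys ! j)"

definition contains_pattern :: "nat \<Rightarrow> (nat \<Rightarrow> nat) \<Rightarrow> nat list \<Rightarrow> bool" where
  "contains_pattern m p pat \<longleftrightarrow>
     (\<exists>xs. subseq xs (one_line m p) \<and> order_isomorphic xs pat)"

definition centrosymmetric_avoiders :: "nat \<Rightarrow> nat list set \<Rightarrow> (nat \<Rightarrow> nat) set" where
  "centrosymmetric_avoiders m T =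
     {p. p permutes {1..m} \<and> centrosymmetric m p \<and> (\<forall>pat\<in>T. \<not> contains_pattern m p pat)}"

end

theory Submission
  imports Defs
begin

text \<open>
  Merging the patterns \<open>1243\<close> and \<open>2143\<close>, a permutation is forbidden as soon as some inversion
  \<open>c \<dots> d\<close> is preceded by two entries smaller than both, in whichever order those two come.
  For a centrosymmetric permutation the reverse-complement of this condition holds as well: two
  decreasing entries are never followed by two larger entries.
  
  Let \<open>c\<^sub>n\<close> be the number of avoiders of length \<open>N = 2n\<close>. Points are deleted together with
  their images under the rotation, in symmetric pairs, from an avoider \<open>p\<close> of length \<open>N\<close>.
  
  \<^item> If \<open>p 1 \<ge> N - 1\<close>, neither the first nor the last entry can take part in a forbidden pattern;
    deleting them leaves an arbitrary avoider. This accounts for \<open>2 c\<^bsub>n-1\<^esub>\<close> permutations.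
  \<^item> If \<open>p 1 \<le> N - 2\<close>, then \<open>p 1 < p 2\<close>. If \<open>p 2 \<ge> N - 1\<close>, the second entry and its image are
    likewise harmless, and deleting them leaves an avoider whose first entry is not its
    maximum. There are \<open>c\<^bsub>n-1\<^esub> - c\<^bsub>n-2\<^esub>\<close> of those for each of the two values of \<open>p 2\<close>.
  \<^item> If \<open>p 1\<close> and \<open>p 2\<close> are both at most \<open>N - 2\<close>, then \<open>p 3 = p 2 + 1\<close>: the second entry has a
    copy of itself right after it, and copying creates no forbidden pattern. Let \<open>u\<^sub>n\<close> count
    these permutations. Deleting the second entry and its image leads to the avoiders \<open>p'\<close> of
    length \<open>N - 2\<close> with \<open>p' 1 \<le> N - 4\<close> and \<open>p' 2 \<le> N - 3\<close>. Those with \<open>p' 2 \<le> N - 4\<close> are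
    counted by \<open>u\<^bsub>n-1\<^esub>\<close>, and those with \<open>p' 2 = N - 3\<close> number \<open>c\<^bsub>n-2\<^esub> - c\<^bsub>n-3\<^esub>\<close> by the previous
    item. So \<open>u\<^sub>n - c\<^bsub>n-2\<^esub>\<close> does not depend on \<open>n\<close>, and it vanishes for \<open>n = 2\<close>.
  
  Summing up, \<open>c\<^sub>n = 2 c\<^bsub>n-1\<^esub> + 2 (c\<^bsub>n-1\<^esub> - c\<^bsub>n-2\<^esub>) + c\<^bsub>n-2\<^esub> = 4 c\<^bsub>n-1\<^esub> - c\<^bsub>n-2\<^esub>\<close>
  (\<open>card_avoiders_rec\<close>), starting from \<open>c\<^sub>0 = 1\<close> and \<open>c\<^sub>1 = 2\<close>.
  
  In odd length the centre is a fixed point, and it is never essential to a forbidden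
  pattern: one that uses the centre can be replaced, by rotating some of its points, by
  one that does not (\<open>occurrence_avoiding_centre\<close>). Deleting the centre hence gives a bijection with the
  avoiders of the even length just below.
\<close>

section \<open>Permutations in terms of positions and values\<close>

definition centrosymmetric_perms :: "nat \<Rightarrow> (nat \<Rightarrow> nat) set" where
  "centrosymmetric_perms N =
     {p. p permutes {1..N} \<and> (\<forall>i\<in>{1..N}. p (N + 1 - i) = N + 1 - p i)}"

text \<open>
  The entries at \<open>i < j < k < l\<close> form \<open>1243\<close> or \<open>2143\<close>. Leaving the order of \<open>p i\<close> and \<open>p j\<close> open is
  what merges the two patterns.
\<close>

definition occurrence :: "nat \<Rightarrow> (nat \<Rightarrow> nat) \<Rightarrow> nat \<Rightarrow> nat \<Rightarrow> nat \<Rightarrow> nat \<Rightarrow> bool" where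
  "occurrence N p i j k l \<longleftrightarrow>
     1 \<le> i \<and> i < j \<and> j < k \<and> k < l \<and> l \<le> N \<and> p i < p l \<and> p j < p l \<and> p l < p k"

definition has_occurrence :: "nat \<Rightarrow> (nat \<Rightarrow> nat) \<Rightarrow> bool" where
  "has_occurrence N p \<longleftrightarrow> (\<exists>i j k l. occurrence N p i j k l)"

definition avoiders :: "nat \<Rightarrow> (nat \<Rightarrow> nat) set" where
  "avoiders N = {p \<in> centrosymmetric_perms N. \<not> has_occurrence N p}"

lemma has_occurrenceI: "occurrence N p i j k l \<Longrightarrow> has_occurrence N p"
  unfolding has_occurrence_def by blast

lemma has_occurrenceE:
  assumes "has_occurrence N p"
  obtains i j k l where "occurrence N p i j k l"
  using assms unfolding has_occurrence_def by blast

text \<open>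
  Peels off the first entry of a subsequence together with its position, so that pattern
  containment becomes a statement about positions.
\<close>

lemma subseq_Cons_map_upt:
  "subseq (x # xs) (map p [u..<v]) \<longleftrightarrow>
     (\<exists>i. u \<le> i \<and> i < v \<and> p i = x \<and> subseq xs (map p [Suc i..<v]))"
proof (induction "v - u" arbitrary: u)
  case 0
  then show ?case by auto
next
  case (Suc d)
  then have uv: "u < v" by simp
  have IH: "subseq (x # xs) (map p [Suc u..<v]) \<longleftrightarrow>
      (\<exists>i. Suc u \<le> i \<and> i < v \<and> p i = x \<and> subseq xs (map p [Suc i..<v]))"
    using Suc by simp
  have "subseq (x # xs) (map p [u..<v]) \<longleftrightarrow>
      (if x = p u then subseq xs (map p [Suc u..<v]) else subseq (x # xs) (map p [Suc u..<v]))"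
    using uv by (simp add: upt_conv_Cons)
  also have "\<dots> \<longleftrightarrow> (\<exists>i. u \<le> i \<and> i < v \<and> p i = x \<and> subseq xs (map p [Suc i..<v]))"
  proof (cases "x = p u")
    case True
    have "subseq xs (map p [Suc u..<v])" if "u \<le> i" "i < v" "subseq xs (map p [Suc i..<v])" for i
    proof -
      have "[Suc u..<v] = [Suc u..<Suc i] @ [Suc i..<v]"
        using that by (metis Suc_leI Suc_le_mono le_Suc_ex upt_add_eq_append)
      then show ?thesis using that(3) by (metis list_emb_append2 map_append)
    qed
    then show ?thesis using True uv by auto
  next
    case False
    then show ?thesis unfolding if_not_P[OF False] IH by (metis Suc_leD Suc_leI le_neq_implies_less)
  qed
  finally show ?case .
qed

lemma subseq_four_one_line:
  "subseq [w, x, y, z] (one_line m p) \<longleftrightarrow>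
     (\<exists>i j k l. 1 \<le> i \<and> i < j \<and> j < k \<and> k < l \<and> l \<le> m \<and>
        p i = w \<and> p j = x \<and> p k = y \<and> p l = z)"
  (is "?L \<longleftrightarrow> ?R")
proof -
  have "?L \<longleftrightarrow> (\<exists>i. 1 \<le> i \<and> i < m + 1 \<and> p i = w \<and>
      (\<exists>j. Suc i \<le> j \<and> j < m + 1 \<and> p j = x \<and>
      (\<exists>k. Suc j \<le> k \<and> k < m + 1 \<and> p k = y \<and>
      (\<exists>l. Suc k \<le> l \<and> l < m + 1 \<and> p l = z))))"
    unfolding one_line_def subseq_Cons_map_upt by simp
  also have "\<dots> \<longleftrightarrow> ?R"
  proof
    assume ?R
    then obtain i j k l where "1 \<le> i" "i < j" "j < k" "k < l" "l \<le> m"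
      "p i = w" "p j = x" "p k = y" "p l = z" by blast
    then show "\<exists>i. 1 \<le> i \<and> i < m + 1 \<and> p i = w \<and>
      (\<exists>j. Suc i \<le> j \<and> j < m + 1 \<and> p j = x \<and>
      (\<exists>k. Suc j \<le> k \<and> k < m + 1 \<and> p k = y \<and>
      (\<exists>l. Suc k \<le> l \<and> l < m + 1 \<and> p l = z)))"
      by (intro exI[of _ i] exI[of _ j] exI[of _ k] exI[of _ l] conjI) auto
  qed (auto simp: Suc_le_eq less_Suc_eq_le)
  finally show ?thesis .
qed

lemma contains_pattern_four:
  "contains_pattern m p [a, b, c, d] \<longleftrightarrow>
     (\<exists>i j k l. 1 \<le> i \<and> i < j \<and> j < k \<and> k < l \<and> l \<le> m \<and>
        order_isomorphic [p i, p j, p k, p l] [a, b, c, d])"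
proof -
  have "\<exists>w x y z. xs = [w, x, y, z]" if "order_isomorphic xs [a, b, c, d]" for xs
  proof -
    have "length xs = Suc (Suc (Suc (Suc 0)))" using that by (simp add: order_isomorphic_def)
    then show ?thesis by (auto simp: length_Suc_conv)
  qed
  then have "contains_pattern m p [a, b, c, d] \<longleftrightarrow>
      (\<exists>w x y z. subseq [w, x, y, z] (one_line m p) \<and> order_isomorphic [w, x, y, z] [a, b, c, d])"
    unfolding contains_pattern_def by blast
  then show ?thesis unfolding subseq_four_one_line by blast
qed

lemma order_isomorphic_four:
  "order_isomorphic [w, x, y, z] [1, 2, 4, 3] \<longleftrightarrow> w < x \<and> x < z \<and> z < y"
  "order_isomorphic [w, x, y, z] [2, 1, 4, 3] \<longleftrightarrow> x < w \<and> w < z \<and> z < y"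
proof -
  have all: "(\<forall>i<Suc (Suc (Suc (Suc 0))). P i) \<longleftrightarrow>
      P 0 \<and> P (Suc 0) \<and> P (Suc (Suc 0)) \<and> P (Suc (Suc (Suc 0)))" for P :: "nat \<Rightarrow> bool"
    by (simp add: All_less_Suc conj_ac)
  show "order_isomorphic [w, x, y, z] [1, 2, 4, 3] \<longleftrightarrow> w < x \<and> x < z \<and> z < y"
    "order_isomorphic [w, x, y, z] [2, 1, 4, 3] \<longleftrightarrow> x < w \<and> w < z \<and> z < y"
    unfolding order_isomorphic_def by (rule iffI; simp add: all)+
qed

lemma centrosymmetric_iff:
  assumes p: "p permutes {1..N}"
  shows "centrosymmetric N p \<longleftrightarrow> (\<forall>i\<in>{1..N}. p (N + 1 - i) = N + 1 - p i)"
proof -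
  have "N + 1 - p (N + 1 - i) = p i \<longleftrightarrow> p (N + 1 - i) = N + 1 - p i" if "i \<in> {1..N}" for i
  proof -
    have "N + 1 - i \<in> {1..N}" using that by auto
    then have "p i \<in> {1..N}" "p (N + 1 - i) \<in> {1..N}"
      using permutes_in_image[OF p] that by blast+
    then show ?thesis by auto
  qed
  moreover have "centrosymmetric N p \<longleftrightarrow> (\<forall>i\<in>{1..N}. N + 1 - p (N + 1 - i) = p i)"
  proof -
    have "p i = i" if "i \<notin> {1..N}" for i using permutes_not_in[OF p that] .
    then show ?thesis
      unfolding centrosymmetric_def reverse_complement_def fun_eq_iff by metis
  qed
  ultimately show ?thesis by blast
qed

lemma has_occurrence_iff_contains_pattern:
  assumes p: "p permutes {1..N}"
  shows "has_occurrence N p \<longleftrightarrow> contains_pattern N p [1, 2, 4, 3] \<or> contains_pattern N p [2, 1, 4, 3]"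
proof -
  have "occurrence N p i j k l \<longleftrightarrow>
      1 \<le> i \<and> i < j \<and> j < k \<and> k < l \<and> l \<le> N \<and>
        order_isomorphic [p i, p j, p k, p l] [1, 2, 4, 3] \<or>
      1 \<le> i \<and> i < j \<and> j < k \<and> k < l \<and> l \<le> N \<and>
        order_isomorphic [p i, p j, p k, p l] [2, 1, 4, 3]" for i j k l
  proof (cases "i < j")
    case True
    then have "p i \<noteq> p j" using injD[OF permutes_inj[OF p], of i j] True by auto
    then have "p i < p l \<and> p j < p l \<and> p l < p k \<longleftrightarrow>
        p i < p j \<and> p j < p l \<and> p l < p k \<or> p j < p i \<and> p i < p l \<and> p l < p k"
      by (cases "p i < p j") auto
    then show ?thesis unfolding occurrence_def order_isomorphic_four by (simp add: conj_disj_distribL)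
  qed (simp add: occurrence_def)
  then have "occurrence N p = (\<lambda>i j k l.
      1 \<le> i \<and> i < j \<and> j < k \<and> k < l \<and> l \<le> N \<and>
        order_isomorphic [p i, p j, p k, p l] [1, 2, 4, 3] \<or>
      1 \<le> i \<and> i < j \<and> j < k \<and> k < l \<and> l \<le> N \<and>
        order_isomorphic [p i, p j, p k, p l] [2, 1, 4, 3])" by (intro ext)
  then show ?thesis
    unfolding contains_pattern_four has_occurrence_def by (simp only: ex_disj_distrib)
qed

lemma centrosymmetric_avoiders_eq:
  "centrosymmetric_avoiders N {[1, 2, 4, 3], [2, 1, 4, 3]} = avoiders N"
proof (rule set_eqI)
  fix p
  show "p \<in> centrosymmetric_avoiders N {[1, 2, 4, 3], [2, 1, 4, 3]} \<longleftrightarrow> p \<in> avoiders N"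
  proof (cases "p permutes {1..N}")
    case True
    then show ?thesis
      using centrosymmetric_iff[OF True] has_occurrence_iff_contains_pattern[OF True]
      by (simp add: centrosymmetric_avoiders_def centrosymmetric_perms_def avoiders_def)
  qed (simp add: centrosymmetric_avoiders_def centrosymmetric_perms_def avoiders_def)
qed

lemma
  assumes "p \<in> centrosymmetric_perms N"
  shows perm_range: "i \<in> {1..N} \<Longrightarrow> p i \<in> {1..N}"
    and perm_mirror: "i \<in> {1..N} \<Longrightarrow> p (N + 1 - i) = N + 1 - p i"
    and perm_inj: "p i = p j \<longleftrightarrow> i = j"
    and perm_onto: "y \<in> {1..N} \<Longrightarrow> \<exists>x\<in>{1..N}. p x = y"
    and perm_outside: "i \<notin> {1..N} \<Longrightarrow> p i = i"
proof -
  have p: "p permutes {1..N}" and "\<forall>i\<in>{1..N}. p (N + 1 - i) = N + 1 - p i"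
    using assms by (auto simp: centrosymmetric_perms_def)
  then show "i \<in> {1..N} \<Longrightarrow> p (N + 1 - i) = N + 1 - p i" by blast
  show "i \<in> {1..N} \<Longrightarrow> p i \<in> {1..N}" using permutes_in_image[OF p] by blast
  show "p i = p j \<longleftrightarrow> i = j" using permutes_inj[OF p] by (simp add: inj_eq)
  show "y \<in> {1..N} \<Longrightarrow> \<exists>x\<in>{1..N}. p x = y" using permutes_image[OF p] by (metis imageE)
  show "i \<notin> {1..N} \<Longrightarrow> p i = i" using permutes_not_in[OF p] by blast
qed

lemma finite_avoiders: "finite (avoiders N)"
  by (rule finite_subset[OF _ finite_permutations[of "{1..N}"]])
    (auto simp: avoiders_def centrosymmetric_perms_def)

text \<open>
  The patterns \<open>2134\<close> and \<open>2143\<close> are the reverse-complements of \<open>1243\<close> and \<open>2143\<close>, so rotating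
  the four points turns them into an occurrence.
\<close>

lemma has_occurrence_mirror:
  assumes p: "p \<in> centrosymmetric_perms N"
    and ix: "1 \<le> i" "i < j" "j < k" "k < l" "l \<le> N"
    and v: "p j < p i" "p i < p k" "p i < p l"
  shows "has_occurrence N p"
proof -
  have r: "p i \<le> N" "p k \<le> N" "p l \<le> N"
    using perm_range[OF p, of i] perm_range[OF p, of k] perm_range[OF p, of l] ix by simp_all
  have m: "p (N + 1 - i) = N + 1 - p i" "p (N + 1 - j) = N + 1 - p j"
    "p (N + 1 - k) = N + 1 - p k" "p (N + 1 - l) = N + 1 - p l"
    using perm_mirror[OF p] ix by simp_all
  have "1 \<le> N + 1 - l" "N + 1 - l < N + 1 - k" "N + 1 - k < N + 1 - j" "N + 1 - j < N + 1 - i"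
    "N + 1 - i \<le> N"
    using ix by simp_all
  moreover have "p (N + 1 - l) < p (N + 1 - i)" "p (N + 1 - k) < p (N + 1 - i)"
    "p (N + 1 - i) < p (N + 1 - j)"
    unfolding m using r v by simp_all
  ultimately have "occurrence N p (N + 1 - l) (N + 1 - k) (N + 1 - j) (N + 1 - i)"
    unfolding occurrence_def by blast
  then show ?thesis unfolding has_occurrence_def by blast
qed

section \<open>Deleting a symmetric set of points\<close>

text \<open>
  The common principle behind all deletions: a centrosymmetric permutation of length \<open>N\<close> with
  prescribed entries on a symmetric set \<open>A\<close> of positions is determined by the
  standardisation of its other entries, which is an arbitrary centrosymmetric permutation of
  length \<open>M\<close>. The maps \<open>e\<close> and \<open>f\<close> enumerate the remaining positions and the
  remaining values increasingly, so that \<open>p\<close> and its standardisation \<open>p'\<close> are related by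
  \<open>p (e k) = f (p' k)\<close>; any property that can be translated along this relation can be counted on
  either side.
\<close>

lemma card_extensions:
  fixes e f g :: "nat \<Rightarrow> nat"
  assumes e: "strict_mono_on {1..M} e" "e ` {1..M} = {1..N} - A"
    and f: "strict_mono_on {1..M} f" "f ` {1..M} = {1..N} - g ` A"
    and e_mirror: "\<And>k. k \<in> {1..M} \<Longrightarrow> e (M + 1 - k) = N + 1 - e k"
    and f_mirror: "\<And>k. k \<in> {1..M} \<Longrightarrow> f (M + 1 - k) = N + 1 - f k"
    and A: "A \<subseteq> {1..N}" "inj_on g A" "g ` A \<subseteq> {1..N}"
    and g_mirror: "\<And>a. a \<in> A \<Longrightarrow> N + 1 - a \<in> A \<and> g (N + 1 - a) = N + 1 - g a"
    and PP': "\<And>p p'. p \<in> centrosymmetric_perms N \<Longrightarrow> p' \<in> centrosymmetric_perms M \<Longrightarrow>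
          (\<And>a. a \<in> A \<Longrightarrow> p a = g a) \<Longrightarrow>
          (\<And>k. k \<in> {1..M} \<Longrightarrow> p (e k) = f (p' k)) \<Longrightarrow> P p \<longleftrightarrow> P' p'"
  shows "card {p \<in> centrosymmetric_perms N. (\<forall>a\<in>A. p a = g a) \<and> P p}
       = card {p' \<in> centrosymmetric_perms M. P' p'}"
proof -
  define e' where "e' = the_inv_into {1..M} e"
  define f' where "f' = the_inv_into {1..M} f"
  define ext where "ext p' = (\<lambda>k. if k \<in> A then g k else if k \<in> {1..N} then f (p' (e' k)) else k)"
    for p' :: "nat \<Rightarrow> nat"
  define res where "res p = (\<lambda>k. if k \<in> {1..M} then f' (p (e k)) else k)" for p :: "nat \<Rightarrow> nat"
  have ie: "inj_on e {1..M}" and jf: "inj_on f {1..M}"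
    using e(1) f(1) by (auto intro: strict_mono_on_imp_inj_on)
  have e_in: "e k \<in> {1..N}" "e k \<notin> A" if "k \<in> {1..M}" for k
    using e(2) that by blast+
  have e'e: "e' (e k) = k" if "k \<in> {1..M}" for k
    using the_inv_into_f_f[OF ie] that by (simp add: e'_def)
  have f'f: "f' (f k) = k" if "k \<in> {1..M}" for k
    using the_inv_into_f_f[OF jf] that by (simp add: f'_def)
  have e_onto: "\<exists>k\<in>{1..M}. x = e k" if "x \<in> {1..N}" "x \<notin> A" for x
    using e(2) that by blast
  have fin: "f k \<in> {1..N}" "f k \<notin> g ` A" if "k \<in> {1..M}" for k
    using f(2) that by blast+
  have extA: "ext p' a = g a" if "a \<in> A" for p' a
    using that by (simp add: ext_def)
  have exte: "ext p' (e k) = f (p' k)" if "k \<in> {1..M}" for p' k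
    using e_in[OF that] e'e[OF that] by (simp add: ext_def)
  have ext_in: "ext p' \<in> centrosymmetric_perms N" if p': "p' \<in> centrosymmetric_perms M" for p'
  proof -
    have into: "ext p' x \<in> {1..N}" if "x \<in> {1..N}" for x
    proof (cases "x \<in> A")
      case True
      then show ?thesis using extA A(3) by auto
    next
      case False
      then obtain k where "k \<in> {1..M}" "x = e k" using e_onto \<open>x \<in> {1..N}\<close> by blast
      then show ?thesis using exte fin(1) perm_range[OF p'] by metis
    qed
    have "inj_on (ext p') {1..N}"
    proof (rule inj_onI)
      fix x y assume x: "x \<in> {1..N}" and y: "y \<in> {1..N}" and eq: "ext p' x = ext p' y"
      have mix: False if "z \<in> A" "k \<in> {1..M}" "ext p' z = ext p' (e k)" for z k
        using that exte[of k] extA[of z] fin(2)[OF perm_range[OF p', of k]] by (metis imageI)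
      consider "x \<in> A" "y \<in> A" | "x \<in> A" "y \<notin> A" | "x \<notin> A" "y \<in> A" | "x \<notin> A" "y \<notin> A" by blast
      then show "x = y"
      proof cases
        case 1
        then show ?thesis using eq extA A(2) by (metis inj_onD)
      next
        case 2
        then show ?thesis using mix[of x] eq e_onto[OF y] by metis
      next
        case 3
        then show ?thesis using mix[of y] eq e_onto[OF x] by metis
      next
        case 4
        then obtain k l where kl: "k \<in> {1..M}" "l \<in> {1..M}" "x = e k" "y = e l"
          using e_onto x y by blast
        then have "f (p' k) = f (p' l)" using eq exte by metis
        then have "p' k = p' l"
          using inj_onD[OF jf _ perm_range[OF p' kl(1)] perm_range[OF p' kl(2)]] by blast
        then show ?thesis using kl by (simp add: perm_inj[OF p'])
      qed
    qed
    then have "bij_betw (ext p') {1..N} {1..N}"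
      using into by (metis bij_betw_def endo_inj_surj finite_atLeastAtMost image_subsetI)
    then have perm: "ext p' permutes {1..N}"
      by (rule bij_imp_permutes) (use A(1) in \<open>auto simp: ext_def\<close>)
    have "ext p' (N + 1 - x) = N + 1 - ext p' x" if x: "x \<in> {1..N}" for x
    proof (cases "x \<in> A")
      case True
      then show ?thesis using extA g_mirror by metis
    next
      case False
      then obtain k where k: "k \<in> {1..M}" "x = e k" using e_onto x by blast
      have k': "M + 1 - k \<in> {1..M}" using k by auto
      have "ext p' (N + 1 - x) = ext p' (e (M + 1 - k))" using k e_mirror by simp
      also have "\<dots> = f (M + 1 - p' k)" using exte[OF k'] perm_mirror[OF p' k(1)] by simp
      also have "\<dots> = N + 1 - ext p' x"
        using f_mirror[OF perm_range[OF p' k(1)]] exte[OF k(1)] k(2) by simp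
      finally show ?thesis .
    qed
    then show ?thesis using perm unfolding centrosymmetric_perms_def by blast
  qed
  have res_f: "f (res p k) = p (e k)" and res_range: "res p k \<in> {1..M}"
    if p: "p \<in> centrosymmetric_perms N" "\<forall>a\<in>A. p a = g a" and k: "k \<in> {1..M}" for p k
  proof -
    have "p (e k) \<notin> g ` A" using p e_in(2)[OF k] perm_inj[OF p(1)] by (metis imageE)
    then have "p (e k) \<in> f ` {1..M}"
      using f(2) perm_range[OF p(1) e_in(1)[OF k]] by blast
    then obtain l where l: "l \<in> {1..M}" "p (e k) = f l" by blast
    then have "res p k = l" using f'f k by (simp add: res_def)
    then show "f (res p k) = p (e k)" "res p k \<in> {1..M}" using l by simp_all
  qed
  have res_in: "res p \<in> centrosymmetric_perms M"
    if p: "p \<in> centrosymmetric_perms N" "\<forall>a\<in>A. p a = g a" for p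
  proof -
    have "inj_on (res p) {1..M}"
    proof (rule inj_onI)
      fix k l assume kl: "k \<in> {1..M}" "l \<in> {1..M}" "res p k = res p l"
      then have "p (e k) = p (e l)" using res_f[OF p kl(1)] res_f[OF p kl(2)] by simp
      then have "e k = e l" by (simp add: perm_inj[OF p(1)])
      then show "k = l" using inj_onD[OF ie _ kl(1,2)] by blast
    qed
    then have "bij_betw (res p) {1..M} {1..M}"
      using res_range[OF p] by (metis bij_betw_def endo_inj_surj finite_atLeastAtMost image_subsetI)
    then have perm: "res p permutes {1..M}"
      by (rule bij_imp_permutes) (auto simp: res_def)
    have "res p (M + 1 - k) = M + 1 - res p k" if k: "k \<in> {1..M}" for k
    proof -
      have k': "M + 1 - k \<in> {1..M}" and r': "M + 1 - res p k \<in> {1..M}"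
        using k res_range[OF p k] by auto
      have "f (res p (M + 1 - k)) = p (N + 1 - e k)" using res_f[OF p k'] e_mirror[OF k] by simp
      also have "\<dots> = N + 1 - f (res p k)"
        using perm_mirror[OF p(1) e_in(1)[OF k]] res_f[OF p k] by simp
      also have "\<dots> = f (M + 1 - res p k)" using f_mirror[OF res_range[OF p k]] by simp
      finally show ?thesis using inj_onD[OF jf _ res_range[OF p k'] r'] by blast
    qed
    then show ?thesis using perm unfolding centrosymmetric_perms_def by blast
  qed
  have "bij_betw ext {p' \<in> centrosymmetric_perms M. P' p'}
      {p \<in> centrosymmetric_perms N. (\<forall>a\<in>A. p a = g a) \<and> P p}"
  proof (rule bij_betw_byWitness[where f' = res])
    show "\<forall>p'\<in>{p' \<in> centrosymmetric_perms M. P' p'}. res (ext p') = p'"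
    proof (safe, rule ext)
      fix p' k assume p': "p' \<in> centrosymmetric_perms M"
      show "res (ext p') k = p' k"
        using exte[of k p'] f'f[OF perm_range[OF p', of k]] perm_outside[OF p', of k]
        by (auto simp: res_def)
    qed
    show "\<forall>p\<in>{p \<in> centrosymmetric_perms N. (\<forall>a\<in>A. p a = g a) \<and> P p}. ext (res p) = p"
    proof (safe, rule ext)
      fix p x assume p: "p \<in> centrosymmetric_perms N" "\<forall>a\<in>A. p a = g a"
      show "ext (res p) x = p x"
      proof (cases "x \<in> A \<or> x \<notin> {1..N}")
        case True
        then show ?thesis using p(2) perm_outside[OF p(1), of x] by (auto simp: ext_def)
      next
        case False
        then obtain k where "k \<in> {1..M}" "x = e k" using e_onto by blast
        then show ?thesis using exte res_f[OF p] by metis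
      qed
    qed
    show "ext ` {p' \<in> centrosymmetric_perms M. P' p'}
        \<subseteq> {p \<in> centrosymmetric_perms N. (\<forall>a\<in>A. p a = g a) \<and> P p}"
    proof safe
      fix p' assume p': "p' \<in> centrosymmetric_perms M" "P' p'"
      show "ext p' \<in> centrosymmetric_perms N" using ext_in[OF p'(1)] .
      show "ext p' a = g a" if "a \<in> A" for a using extA[OF that] .
      show "P (ext p')" using PP'[OF ext_in[OF p'(1)] p'(1) extA exte] p'(2) by blast
    qed
    show "res ` {p \<in> centrosymmetric_perms N. (\<forall>a\<in>A. p a = g a) \<and> P p}
        \<subseteq> {p' \<in> centrosymmetric_perms M. P' p'}"
    proof safe
      fix p assume p: "p \<in> centrosymmetric_perms N" "\<forall>a\<in>A. p a = g a" "P p"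
      show "res p \<in> centrosymmetric_perms M" using res_in[OF p(1,2)] .
      show "P' (res p)"
        using PP'[OF p(1) res_in[OF p(1,2)]] res_f[OF p(1,2)] p(2,3) by auto
    qed
  qed
  from bij_betw_same_card[OF this] show ?thesis by (rule sym)
qed

text \<open>
  Standardisation preserves the order of positions and of values, hence also patterns.
\<close>

lemma has_occurrence_extension:
  assumes e: "strict_mono_on {1..M} e" "e ` {1..M} = {1..N} - A"
    and f: "strict_mono_on {1..M} f"
    and p': "p' \<in> centrosymmetric_perms M"
    and pe: "\<And>k. k \<in> {1..M} \<Longrightarrow> p (e k) = f (p' k)"
  shows "has_occurrence M p' \<longleftrightarrow>
    (\<exists>i j k l. occurrence N p i j k l \<and> i \<notin> A \<and> j \<notin> A \<and> k \<notin> A \<and> l \<notin> A)"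
proof -
  have ein: "e k \<in> {1..N} - A" if "k \<in> {1..M}" for k using e(2) that by blast
  have lt: "e x < e y \<longleftrightarrow> x < y" if "x \<in> {1..M}" "y \<in> {1..M}" for x y
    using strict_mono_on_less[OF e(1)] that by blast
  have vlt: "p (e x) < p (e y) \<longleftrightarrow> p' x < p' y" if "x \<in> {1..M}" "y \<in> {1..M}" for x y
    using strict_mono_on_less[OF f] perm_range[OF p'] pe that by simp
  have key: "occurrence M p' i j k l \<longleftrightarrow> occurrence N p (e i) (e j) (e k) (e l)"
    if "i \<in> {1..M}" "j \<in> {1..M}" "k \<in> {1..M}" "l \<in> {1..M}" for i j k l
    unfolding occurrence_def using that lt vlt ein[of i] ein[of l] by auto
  show ?thesis
  proof
    assume "has_occurrence M p'"
    then obtain i j k l where b: "occurrence M p' i j k l" unfolding has_occurrence_def by blast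
    then have "i \<in> {1..M}" "j \<in> {1..M}" "k \<in> {1..M}" "l \<in> {1..M}" unfolding occurrence_def by auto
    then show "\<exists>i j k l. occurrence N p i j k l \<and> i \<notin> A \<and> j \<notin> A \<and> k \<notin> A \<and> l \<notin> A"
      using key b ein by blast
  next
    assume "\<exists>i j k l. occurrence N p i j k l \<and> i \<notin> A \<and> j \<notin> A \<and> k \<notin> A \<and> l \<notin> A"
    then obtain i j k l where b: "occurrence N p i j k l" "i \<notin> A" "j \<notin> A" "k \<notin> A" "l \<notin> A" by blast
    then have "i \<in> {1..N} - A" "j \<in> {1..N} - A" "k \<in> {1..N} - A" "l \<in> {1..N} - A"
      unfolding occurrence_def by auto
    then obtain i' j' k' l' where "i' \<in> {1..M}" "j' \<in> {1..M}" "k' \<in> {1..M}" "l' \<in> {1..M}"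
      "i = e i'" "j = e j'" "k = e k'" "l = e l'" unfolding e(2)[symmetric] by blast
    then show "has_occurrence M p'" using key b(1) unfolding has_occurrence_def by blast
  qed
qed

section \<open>Deleting a symmetric pair of points\<close>

text \<open>
  The increasing enumeration of \<open>{1..N} - {a, N + 1 - a}\<close>, for positions as well as for values. The
  minimum and the maximum are there because a deleted value \<open>a\<close> may lie in either half of \<open>{1..N}\<close>.
\<close>

definition skip :: "nat \<Rightarrow> nat \<Rightarrow> nat \<Rightarrow> nat" where
  "skip N a k = (if k < min a (N + 1 - a) then k
                 else if k + 1 < max a (N + 1 - a) then k + 1 else k + 2)"

lemma strict_mono_skip: "strict_mono_on S (skip N a)"
  by (rule strict_mono_onI) (auto simp: skip_def)

text \<open>
  In even length a point differs from its image, so the pair can be sorted strictly.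
\<close>

lemma pair_sorted:
  assumes "even N" "a \<in> {1..N}"
  obtains b c where "b < c" "b + c = N + 1" "1 \<le> b" "{a, N + 1 - a} = {b, c}"
    "skip N a = (\<lambda>k. if k < b then k else if k + 1 < c then k + 1 else k + 2)"
proof
  show "min a (N + 1 - a) < max a (N + 1 - a)"
    using assms by (auto elim!: evenE) presburger
  show "min a (N + 1 - a) + max a (N + 1 - a) = N + 1" "1 \<le> min a (N + 1 - a)"
    using assms(2) by auto
  show "{a, N + 1 - a} = {min a (N + 1 - a), max a (N + 1 - a)}" by (auto simp: min_def max_def)
qed (simp add: skip_def fun_eq_iff)

lemma skip_image:
  assumes N: "N = M + 2" "even N" and a: "a \<in> {1..N}"
  shows "skip N a ` {1..M} = {1..N} - {a, N + 1 - a}"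
proof -
  obtain b c where bc: "b < c" "b + c = N + 1" "1 \<le> b" and A: "{a, N + 1 - a} = {b, c}"
    and skip: "skip N a = (\<lambda>k. if k < b then k else if k + 1 < c then k + 1 else k + 2)"
    by (rule pair_sorted[OF N(2) a])
  have "x \<in> skip N a ` {1..M}" if x: "x \<in> {1..N}" "x \<noteq> b" "x \<noteq> c" for x
  proof -
    define k where "k = (if x < b then x else if x < c then x - 1 else x - 2)"
    have "k \<in> {1..M}" "skip N a k = x"
      using x bc N(1) unfolding skip k_def by auto
    then show ?thesis by blast
  qed
  moreover have "skip N a k \<in> {1..N} - {b, c}" if "k \<in> {1..M}" for k
    using that bc N(1) unfolding skip by auto
  ultimately show ?thesis unfolding A by blast
qed

lemma skip_mirror:
  assumes N: "N = M + 2" "even N" and a: "a \<in> {1..N}" and k: "k \<in> {1..M}"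
  shows "skip N a (M + 1 - k) = N + 1 - skip N a k"
proof -
  obtain b c where bc: "b < c" "b + c = N + 1" "1 \<le> b" and "{a, N + 1 - a} = {b, c}"
    and skip: "skip N a = (\<lambda>k. if k < b then k else if k + 1 < c then k + 1 else k + 2)"
    by (rule pair_sorted[OF N(2) a])
  consider "k < b" | "b \<le> k" "k + 1 < c" | "c \<le> k + 1" by linarith
  then show ?thesis
  proof cases
    case 1
    then have "\<not> M + 1 - k < b" "\<not> M + 1 - k + 1 < c" using bc N(1) k by auto
    then show ?thesis using 1 N(1) k unfolding skip by simp
  next
    case 2
    then have "\<not> M + 1 - k < b" "M + 1 - k + 1 < c" using bc N(1) k by auto
    then have "skip N a (M + 1 - k) = M + 1 - k + 1" "skip N a k = k + 1"
      using 2 unfolding skip by simp_all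
    then show ?thesis using N(1) k by auto
  next
    case 3
    then have "M + 1 - k < b" "\<not> k < b" using bc N(1) k by auto
    then show ?thesis using 3 N(1) k unfolding skip by simp
  qed
qed

text \<open>
  Symmetry forces the entry at \<open>N + 1 - a\<close> once the one at \<open>a\<close> is prescribed. Since the deletion
  preserves patterns, avoidance after the deletion means that every occurrence before it
  uses one of the two deleted points; this is handed on to the property to be translated.
\<close>

lemma card_pair_deletion:
  assumes N: "N = M + 2" "even N" and a: "a \<in> {1..N}" and c: "c \<in> {1..N}"
    and PP': "\<And>p p'. p \<in> centrosymmetric_perms N \<Longrightarrow> p' \<in> centrosymmetric_perms M \<Longrightarrow>
        p a = c \<Longrightarrow> (\<And>k. k \<in> {1..M} \<Longrightarrow> p (skip N a k) = skip N c (p' k)) \<Longrightarrow>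
        (has_occurrence M p' \<longleftrightarrow> (\<exists>i j k l. occurrence N p i j k l \<and>
            {i, j, k, l} \<inter> {a, N + 1 - a} = {})) \<Longrightarrow>
        P p \<longleftrightarrow> P' p'"
  shows "card {p \<in> centrosymmetric_perms N. p a = c \<and> P p}
       = card {p' \<in> centrosymmetric_perms M. P' p'}"
proof -
  define A where "A = {a, N + 1 - a}"
  define g where "g x = (if x = a then c else N + 1 - c)" for x :: nat
  have "a \<noteq> N + 1 - a" using N(2) a by (auto elim!: evenE) presburger
  then have ga: "g a = c" "g (N + 1 - a) = N + 1 - c" by (auto simp: g_def)
  have gA: "g ` A = {c, N + 1 - c}" unfolding A_def using ga by auto
  have "c \<noteq> N + 1 - c" using N(2) c by (auto elim!: evenE) presburger
  then have inj: "inj_on g A" unfolding A_def inj_on_def using ga by auto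
  have eq: "(\<forall>x\<in>A. p x = g x) \<longleftrightarrow> p a = c" if "p \<in> centrosymmetric_perms N" for p
    using perm_mirror[OF that a] ga unfolding A_def by auto
  have e: "skip N a ` {1..M} = {1..N} - A" unfolding A_def by (rule skip_image[OF N a])
  have f: "skip N c ` {1..M} = {1..N} - g ` A" unfolding gA by (rule skip_image[OF N c])
  have "card {p \<in> centrosymmetric_perms N. (\<forall>x\<in>A. p x = g x) \<and> P p}
      = card {p' \<in> centrosymmetric_perms M. P' p'}"
  proof (rule card_extensions[OF strict_mono_skip e strict_mono_skip f])
    fix p p' assume p: "p \<in> centrosymmetric_perms N" and p': "p' \<in> centrosymmetric_perms M"
      and g: "\<And>x. x \<in> A \<Longrightarrow> p x = g x"
      and pe: "\<And>k. k \<in> {1..M} \<Longrightarrow> p (skip N a k) = skip N c (p' k)"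
    have "has_occurrence M p' \<longleftrightarrow> (\<exists>i j k l. occurrence N p i j k l \<and> {i, j, k, l} \<inter> A = {})"
      by (subst has_occurrence_extension[OF strict_mono_skip e strict_mono_skip p' pe]) simp_all
    then show "P p \<longleftrightarrow> P' p'"
      using PP'[OF p p' _ pe] g[of a] ga(1) unfolding A_def by simp
  next
    show "N + 1 - x \<in> A \<and> g (N + 1 - x) = N + 1 - g x" if x: "x \<in> A" for x
    proof -
      consider "x = a" | "x = N + 1 - a" using x unfolding A_def by blast
      then show ?thesis
      proof cases
        case 1
        then show ?thesis using ga unfolding A_def by simp
      next
        case 2
        then have "N + 1 - x = a" using a by auto
        then show ?thesis using ga 2 c unfolding A_def by simp
      qed
    qed
    show "A \<subseteq> {1..N}" using a unfolding A_def by auto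
    show "g ` A \<subseteq> {1..N}" using c unfolding gA by auto
  qed (use skip_mirror[OF N a] skip_mirror[OF N c] inj in auto)
  moreover have "{p \<in> centrosymmetric_perms N. (\<forall>x\<in>A. p x = g x) \<and> P p}
      = {p \<in> centrosymmetric_perms N. p a = c \<and> P p}"
    using eq by blast
  ultimately show ?thesis by simp
qed

section \<open>The first three entries\<close>

text \<open>
  Otherwise the first two entries decrease, and the values \<open>N - 1\<close> and \<open>N\<close>, which come later,
  complete them to \<open>2134\<close> or \<open>2143\<close>.
\<close>

lemma first_less_second:
  assumes p: "p \<in> avoiders N" and v: "p 1 \<le> N - 2" and N: "2 \<le> N"
  shows "p 1 < p 2"
proof (rule ccontr)
  have cs: "p \<in> centrosymmetric_perms N" and nb: "\<not> has_occurrence N p" using p by (auto simp: avoiders_def)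
  assume "\<not> p 1 < p 2"
  moreover have "p 1 \<noteq> p 2" by (simp add: perm_inj[OF cs])
  ultimately have lt: "p 2 < p 1" by linarith
  have top: "N - 1 \<in> {1..N}" "N \<in> {1..N}" using N by auto
  obtain r where r: "r \<in> {1..N}" "p r = N - 1" using perm_onto[OF cs top(1)] by blast
  obtain s where s: "s \<in> {1..N}" "p s = N" using perm_onto[OF cs top(2)] by blast
  have "1 \<le> p 1" using perm_range[OF cs, of 1] N by auto
  have "r \<noteq> 1" "r \<noteq> 2" "s \<noteq> 1" "s \<noteq> 2" "r \<noteq> s"
    using r(2) s(2) lt v N \<open>1 \<le> p 1\<close> by auto
  then have rs: "2 < r" "2 < s" using r(1) s(1) by auto
  have gt: "p 1 < p r" "p 1 < p s" using r(2) s(2) v N by linarith+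
  consider "r < s" | "s < r" using \<open>r \<noteq> s\<close> by linarith
  then show False
  proof cases
    case 1
    then show False using has_occurrence_mirror[of p N 1 2 r s] cs rs r(1) s(1) lt gt nb by simp
  next
    case 2
    then show False using has_occurrence_mirror[of p N 1 2 s r] cs rs r(1) s(1) lt gt nb by simp
  qed
qed

text \<open>
  The first two entries increase, so by avoidance of \<open>1243\<close> the later entries above \<open>p 2\<close> increase
  too. If \<open>p 3\<close> were below \<open>p 2\<close>, the entries \<open>p 2\<close> and \<open>p 3\<close> would be completed to \<open>2134\<close> or \<open>2143\<close> by the
  values \<open>N - 1\<close> and \<open>N\<close>. Hence \<open>p 3\<close> is the least entry above \<open>p 2\<close>.
\<close>

lemma third_is_second_plus_one:
  assumes p: "p \<in> avoiders N" and v: "p 1 \<le> N - 2" and x: "p 2 \<le> N - 2" and N: "2 \<le> N"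
  shows "p 3 = p 2 + 1"
proof -
  have cs: "p \<in> centrosymmetric_perms N" and nb: "\<not> has_occurrence N p" using p by (auto simp: avoiders_def)
  have vx: "p 1 < p 2" using first_less_second[OF p v N] .
  have v1: "1 \<le> p 1" using perm_range[OF cs, of 1] N by auto
  have N4: "4 \<le> N" using vx v1 x by linarith
  have incr: "p k < p l" if "2 < k" "k < l" "l \<le> N" "p 2 < p k" "p 2 < p l" for k l
  proof (rule ccontr)
    assume "\<not> p k < p l"
    moreover have "p k \<noteq> p l" using that by (simp add: perm_inj[OF cs])
    ultimately have "occurrence N p 1 2 k l" using that vx unfolding occurrence_def by auto
    then show False using nb unfolding has_occurrence_def by blast
  qed
  have yx: "p 2 < p 3"
  proof (rule ccontr)
    assume "\<not> p 2 < p 3"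
    moreover have "p 2 \<noteq> p 3" by (simp add: perm_inj[OF cs])
    ultimately have lt: "p 3 < p 2" by linarith
    have top: "N - 1 \<in> {1..N}" "N \<in> {1..N}" using N by auto
    obtain r where r: "r \<in> {1..N}" "p r = N - 1" using perm_onto[OF cs top(1)] by blast
    obtain s where s: "s \<in> {1..N}" "p s = N" using perm_onto[OF cs top(2)] by blast
    have "r \<noteq> 1" "r \<noteq> 2" "r \<noteq> 3" "s \<noteq> 1" "s \<noteq> 2" "s \<noteq> 3" "r \<noteq> s"
      using r(2) s(2) lt v x N4 by auto
    then have rs: "3 < r" "3 < s" using r(1) s(1) by auto
    have gt: "p 2 < p r" "p 2 < p s" using r(2) s(2) x N by linarith+
    consider "r < s" | "s < r" using \<open>r \<noteq> s\<close> by linarith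
    then show False
    proof cases
      case 1
      then show False using has_occurrence_mirror[of p N 2 3 r s] cs rs r(1) s(1) lt gt nb by simp
    next
      case 2
      then show False using has_occurrence_mirror[of p N 2 3 s r] cs rs r(1) s(1) lt gt nb by simp
    qed
  qed
  have "p 2 + 1 \<in> {1..N}" using x N4 by simp
  then obtain t where t: "t \<in> {1..N}" "p t = p 2 + 1" using perm_onto[OF cs] by blast
  have "t \<noteq> 1" "t \<noteq> 2" using t(2) vx by auto
  then have "3 \<le> t" using t(1) by auto
  moreover have "\<not> 3 < t" using incr[of 3 t] yx t by auto
  ultimately have "t = 3" by linarith
  then show ?thesis using t(2) by simp
qed

section \<open>A large first or second entry\<close>

text \<open>
  An entry that has at most one larger entry cannot be one of the two small ones of an
  occurrence, and positions \<open>1\<close> and \<open>2\<close> are too early for its two large ones. By symmetry the image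
  of such an entry is too small to be a large one and too late to be a small one.
\<close>

lemma occurrence_avoids_large_entry:
  assumes p: "p \<in> centrosymmetric_perms N" and a: "a \<in> {1, 2}" "2 * a \<le> N" and c: "N - 1 \<le> p a"
    and b: "occurrence N p i j k l"
  shows "{i, j, k, l} \<inter> {a, N + 1 - a} = {}"
proof -
  have ix: "1 \<le> i" "i < j" "j < k" "k < l" "l \<le> N" and v: "p i < p l" "p j < p l" "p l < p k"
    using b unfolding occurrence_def by auto
  have r: "1 \<le> p i" "1 \<le> p j" "p k \<le> N"
    using perm_range[OF p, of i] perm_range[OF p, of j] perm_range[OF p, of k] ix by auto
  have "p i \<noteq> p j" using ix by (simp add: perm_inj[OF p])
  then have l3: "3 \<le> p l" using r v by linarith
  have m: "p (N + 1 - a) \<le> 2" using perm_mirror[OF p, of a] a c by auto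
  have "i \<noteq> a" "j \<noteq> a" using c v r(3) by auto
  moreover have "k \<noteq> N + 1 - a" "l \<noteq> N + 1 - a" using l3 m v by auto
  moreover have "k \<noteq> a" "l \<noteq> a" "i \<noteq> N + 1 - a" "j \<noteq> N + 1 - a" using ix a by auto
  ultimately show ?thesis by blast
qed

lemma card_delete_large:
  assumes N: "N = M + 2" "even N" and a: "a \<in> {1, 2}" "2 * a \<le> N" and c: "c = N \<or> c = N - 1"
    and QQ': "\<And>p p'. p \<in> centrosymmetric_perms N \<Longrightarrow> p' \<in> centrosymmetric_perms M \<Longrightarrow>
        (\<And>k. k \<in> {1..M} \<Longrightarrow> p (skip N a k) = skip N c (p' k)) \<Longrightarrow> Q p \<longleftrightarrow> Q' p'"
  shows "card {p \<in> avoiders N. Q p \<and> p a = c} = card {p' \<in> avoiders M. Q' p'}"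
proof -
  have "card {p \<in> centrosymmetric_perms N. p a = c \<and> \<not> has_occurrence N p \<and> Q p}
      = card {p' \<in> centrosymmetric_perms M. \<not> has_occurrence M p' \<and> Q' p'}"
  proof (rule card_pair_deletion[OF N])
    show "a \<in> {1..N}" "c \<in> {1..N}" using N(1) a c by auto
    fix p p' assume p: "p \<in> centrosymmetric_perms N" and p': "p' \<in> centrosymmetric_perms M"
      and pa: "p a = c" and pe: "\<And>k. k \<in> {1..M} \<Longrightarrow> p (skip N a k) = skip N c (p' k)"
      and has_occurrence: "has_occurrence M p' \<longleftrightarrow> (\<exists>i j k l. occurrence N p i j k l \<and>
            {i, j, k, l} \<inter> {a, N + 1 - a} = {})"
    have "N - 1 \<le> p a" using pa c by auto
    then have "has_occurrence M p' \<longleftrightarrow> has_occurrence N p"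
      unfolding has_occurrence has_occurrence_def[of N p] using occurrence_avoids_large_entry[OF p a] by metis
    then show "\<not> has_occurrence N p \<and> Q p \<longleftrightarrow> \<not> has_occurrence M p' \<and> Q' p'" using QQ'[OF p p' pe] by blast
  qed
  moreover have "{p \<in> centrosymmetric_perms N. p a = c \<and> \<not> has_occurrence N p \<and> Q p}
      = {p \<in> avoiders N. Q p \<and> p a = c}" unfolding avoiders_def by blast
  moreover have "{p' \<in> centrosymmetric_perms M. \<not> has_occurrence M p' \<and> Q' p'} = {p' \<in> avoiders M. Q' p'}"
    unfolding avoiders_def by blast
  ultimately show ?thesis by simp
qed

lemma card_first_large:
  assumes "N = M + 2" "even N" "c = N \<or> c = N - 1"
  shows "card {p \<in> avoiders N. p 1 = c} = card (avoiders M)"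
  using card_delete_large[OF assms(1,2) _ _ assms(3), of 1 "\<lambda>_. True" "\<lambda>_. True"] assms(1) by simp

text \<open>
  Of the values \<open>N - 1\<close> and \<open>N\<close>, one is deleted as \<open>p 2\<close> and the other one standardises to \<open>M\<close>. So
  the first entry, which survives the deletion, is at most \<open>N - 2\<close> exactly when it does not become
  the maximum.
\<close>

lemma card_second_large:
  assumes N: "N = M + 2" "even N" "2 \<le> M" and c: "c = N \<or> c = N - 1"
  shows "card {p \<in> avoiders N. p 1 \<le> N - 2 \<and> p 2 = c} = card {p' \<in> avoiders M. p' 1 \<noteq> M}"
proof (rule card_delete_large[OF N(1,2) _ _ c])
  fix p p' assume p': "p' \<in> centrosymmetric_perms M"
    and pe: "\<And>k. k \<in> {1..M} \<Longrightarrow> p (skip N 2 k) = skip N c (p' k)"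
  have "skip N 2 1 = 1" using N by (auto simp: skip_def)
  then have "p 1 = skip N c (p' 1)" using pe[of 1] N by simp
  moreover have "p' 1 \<in> {1..M}" using perm_range[OF p', of 1] N by simp
  ultimately show "p 1 \<le> N - 2 \<longleftrightarrow> p' 1 \<noteq> M" using c N by (auto simp: skip_def)
qed (use N in auto)

section \<open>Small first and second entries\<close>

text \<open>
  The points at positions \<open>2\<close> and \<open>3\<close> are adjacent in position and in value, and so are their
  images at \<open>N - 2\<close> and \<open>N - 1\<close>. An occurrence that contains only one point of such a pair may
  use the other one instead. It can contain both points of a pair only as its two small entries
  at positions \<open>2\<close> and \<open>3\<close>: its two large entries decrease, its second and third entries have the
  value of the fourth between them, and \<open>N - 2\<close> and \<open>N - 1\<close> are too late for the small ones. In
  the remaining case the first entry of \<open>p\<close> replaces the one at position \<open>2\<close>.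
\<close>

lemma occurrence_avoiding_doubled:
  assumes p: "p \<in> centrosymmetric_perms N" and N: "6 \<le> N"
    and p3: "p 3 = p 2 + 1" and p1: "p 1 < p 2" and b: "occurrence N p i j k l"
  shows "\<exists>i j k l. occurrence N p i j k l \<and> {i, j, k, l} \<inter> {2, N + 1 - 2} = {}"
proof -
  have ix: "1 \<le> i" "i < j" "j < k" "k < l" "l \<le> N" and v: "p i < p l" "p j < p l" "p l < p k"
    using b unfolding occurrence_def by auto
  have "p (N - 1) = N + 1 - p 2" "p (N - 2) = N + 1 - p 3"
    using perm_mirror[OF p, of 2] perm_mirror[OF p, of 3] N by simp_all
  moreover have "p 3 \<le> N" using perm_range[OF p, of 3] N by simp
  ultimately have pN: "p (N - 1) = p (N - 2) + 1" using p3 by simp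
  \<comment> \<open>Moves each position that is to be deleted to its neighbour in the doubled pair.\<close>
  define s where "s x = (if x = 2 then 3 else if x = N - 1 then N - 2 else x)" for x
  have s_range: "s x \<noteq> 2" "s x \<noteq> N - 1" "s x \<le> N" if "x \<le> N" for x
    using that N by (auto simp: s_def)
  have s_pos: "s x < s y" if "x < y" "\<not> (x = 2 \<and> y = 3)" "\<not> (x = N - 2 \<and> y = N - 1)" for x y
    using that N by (auto simp: s_def)
  have s_val: "p (s x) < p (s y)"
    if "p x < p y" "\<not> (x = 2 \<and> y = 3)" "\<not> (x = N - 2 \<and> y = N - 1)" for x y
  proof -
    \<comment> \<open>Moving changes a value by one, which could only matter for the two points of a pair,
      by injectivity of \<open>p\<close>.\<close>
    have ps: "p (s z) = (if z = 2 then p 2 + 1 else if z = N - 1 then p (N - 2) else p z)" for z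
      using p3 by (simp add: s_def)
    have ne: "p y \<noteq> p 2 + 1" if "y \<noteq> 3" using that perm_inj[OF p, of y 3] p3 by simp
    have ne': "p x \<noteq> p (N - 2)" if "x \<noteq> N - 2" using that by (simp add: perm_inj[OF p])
    have N2: "N - 1 \<noteq> 2" using N by simp
    have "p 3 \<noteq> p (N - 2)" using N by (simp add: perm_inj[OF p])
    then have ne'': "p (N - 2) \<noteq> p 2 + 1" using p3 by simp
    consider "x = 2" "y = N - 1" | "x = 2" "y \<noteq> N - 1" | "x \<noteq> 2" "y = N - 1"
      | "x \<noteq> 2" "y \<noteq> N - 1" by blast
    then show ?thesis
    proof cases
      case 1
      then have "p 2 < p (N - 2) + 1" "p (N - 2) + 1 \<noteq> p 2 + 1"
        using that(1) pN ne N by auto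
      then show ?thesis using 1 ps[of x] ps[of y] ne'' N2 by simp
    next
      case 2
      then have "y \<noteq> 3" "y \<noteq> 2" using that by auto
      then show ?thesis using 2 ps[of x] ps[of y] ne that(1) by simp
    next
      case 3
      then have "x \<noteq> N - 2" "x \<noteq> N - 1" using that by auto
      then show ?thesis using 3 ps[of x] ps[of y] ne' that(1) pN N2 by simp
    next
      case 4
      have "p (s x) \<le> p x" using 4 ps[of x] pN by auto
      moreover have "p y \<le> p (s y)" using 4 ps[of y] by auto
      ultimately show ?thesis using that(1) by linarith
    qed
  qed
  have kl: "s k < s l" "p (s l) < p (s k)"
  proof -
    have "\<not> (k = N - 2 \<and> l = N - 1)" using v(3) pN by auto
    then show "s k < s l" using s_pos[of k l] ix by auto
    have "\<not> (l = 2 \<and> k = 3)" "\<not> (l = N - 2 \<and> k = N - 1)" using ix by auto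
    then show "p (s l) < p (s k)" by (rule s_val[OF v(3)])
  qed
  have jk: "s j < s k"
  proof -
    have "\<not> (j = 2 \<and> k = 3)" "\<not> (j = N - 2 \<and> k = N - 1)" using v(2,3) p3 pN by auto
    then show ?thesis using s_pos[of j k] ix by auto
  qed
  have "\<not> (j = 2 \<and> l = 3)" "\<not> (j = N - 2 \<and> l = N - 1)" using ix by auto
  then have jl: "p (s j) < p (s l)" by (rule s_val[OF v(2)])
  have "\<not> (i = 2 \<and> l = 3)" "\<not> (i = N - 2 \<and> l = N - 1)" using ix by auto
  then have il: "p (s i) < p (s l)" by (rule s_val[OF v(1)])
  define i' where "i' = (if i = 2 \<and> j = 3 then 1 else s i)"
  have "occurrence N p i' (s j) (s k) (s l)"
  proof (cases "i = 2 \<and> j = 3")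
    case True
    then have "s j = 3" using N by (simp add: s_def)
    then show ?thesis
      using True kl jk jl p1 p3 s_range[of l] ix unfolding occurrence_def i'_def by auto
  next
    case False
    then have "s i < s j" using s_pos[of i j] ix by auto
    moreover have "1 \<le> s i" using ix(1) N by (auto simp: s_def)
    ultimately show ?thesis
      using False kl jk jl il s_range[of l] ix unfolding occurrence_def i'_def by auto
  qed
  moreover have "{i', s j, s k, s l} \<inter> {2, N + 1 - 2} = {}"
  proof -
    have "i \<le> N" "j \<le> N" "k \<le> N" using ix by linarith+
    moreover have "i' \<noteq> 2" "i' \<noteq> N - 1" using s_range[OF \<open>i \<le> N\<close>] N by (auto simp: i'_def)
    moreover have "N + 1 - 2 = N - 1" by simp
    ultimately show ?thesis using s_range(1,2) ix(5) by simp
  qed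
  ultimately show ?thesis by blast
qed

text \<open>
  After deleting the value \<open>j\<close> at position \<open>2\<close> and its image, the value \<open>j + 1\<close> at position \<open>3\<close> moves to
  position \<open>2\<close> and drops by the number of deleted values below it: one if \<open>j\<close> lies in the lower
  half, two otherwise. For \<open>j = n\<close> the value \<open>n + 1\<close> would itself be the deleted image, so this case is
  excluded.
\<close>

lemma card_fixed_second:
  assumes N: "N = M + 2" "N = 2 * n" "3 \<le> n" and j: "j \<in> {1..N - 2}" "j \<noteq> n"
  shows "card {p \<in> avoiders N. p 1 \<le> N - 2 \<and> p 2 = j}
       = card {p' \<in> avoiders M. p' 1 \<le> M - 2 \<and> p' 2 = (if j < n then j else j - 1)}"
proof -
  define h where "h = (if j < n then j else j - 1)"
  have h: "h \<in> {1..M - 1}" using j N by (auto simp: h_def)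
  have skip_h: "skip N j h = j + 1" using N j by (auto simp: h_def skip_def)
  have skip2: "skip N 2 1 = 1" "skip N 2 2 = 3" using N by (auto simp: skip_def)
  have "card {p \<in> centrosymmetric_perms N. p 2 = j \<and> \<not> has_occurrence N p \<and> p 1 \<le> N - 2}
      = card {p' \<in> centrosymmetric_perms M. \<not> has_occurrence M p' \<and> p' 1 \<le> M - 2 \<and> p' 2 = h}"
  proof (rule card_pair_deletion[OF N(1)])
    show "even N" using N(2) by simp
    show "2 \<in> {1..N}" "j \<in> {1..N}" using N j by auto
    fix p p' assume p: "p \<in> centrosymmetric_perms N" and p': "p' \<in> centrosymmetric_perms M"
      and p2: "p 2 = j" and pe: "\<And>k. k \<in> {1..M} \<Longrightarrow> p (skip N 2 k) = skip N j (p' k)"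
      and has_occurrence: "has_occurrence M p' \<longleftrightarrow> (\<exists>i j k l. occurrence N p i j k l \<and>
            {i, j, k, l} \<inter> {2, N + 1 - 2} = {})"
    have p1: "p 1 = skip N j (p' 1)" and p3: "p 3 = skip N j (p' 2)"
      using pe[of 1] pe[of 2] skip2 N by simp_all
    have r: "p' 1 \<in> {1..M}" "p' 2 \<in> {1..M}"
      using perm_range[OF p', of 1] perm_range[OF p', of 2] N by simp_all
    have lt: "skip N j x < skip N j y \<longleftrightarrow> x < y" for x y
      using strict_mono_on_less[OF strict_mono_skip[of UNIV]] by blast
    have eq: "skip N j x = skip N j y \<longleftrightarrow> x = y" for x y
      using lt[of x y] lt[of y x] by (cases x y rule: linorder_cases) auto
    show "\<not> has_occurrence N p \<and> p 1 \<le> N - 2 \<longleftrightarrow> \<not> has_occurrence M p' \<and> p' 1 \<le> M - 2 \<and> p' 2 = h"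
    proof
      assume *: "\<not> has_occurrence N p \<and> p 1 \<le> N - 2"
      then have av: "p \<in> avoiders N" using p by (simp add: avoiders_def)
      have N2: "2 \<le> N" "p 2 \<le> N - 2" using N j p2 by auto
      have "p 3 = p 2 + 1" using third_is_second_plus_one[OF av _ N2(2,1)] * by blast
      then have "skip N j (p' 2) = skip N j h" using p2 p3 skip_h by simp
      then have h': "p' 2 = h" using eq by blast
      have "p 1 < p 2" using first_less_second[OF av _ N2(1)] * by blast
      then have "p 1 < p 3" using \<open>p 3 = p 2 + 1\<close> by simp
      then have "p' 1 < p' 2" using p1 p3 lt by simp
      then have "p' 1 \<le> M - 2" using h h' by auto
      moreover have "\<not> has_occurrence M p'" using * has_occurrence by (blast intro: has_occurrenceI)
      ultimately show "\<not> has_occurrence M p' \<and> p' 1 \<le> M - 2 \<and> p' 2 = h" using h' by blast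
    next
      assume *: "\<not> has_occurrence M p' \<and> p' 1 \<le> M - 2 \<and> p' 2 = h"
      then have av: "p' \<in> avoiders M" using p' by (simp add: avoiders_def)
      have "p' 1 < p' 2" using first_less_second[OF av] * N by simp
      then have "p 1 < p 3" using p1 p3 lt by simp
      moreover have p3': "p 3 = p 2 + 1" using p3 p2 * skip_h by simp
      moreover have "p 1 \<noteq> p 2" by (simp add: perm_inj[OF p])
      ultimately have p12: "p 1 < p 2" by linarith
      have "6 \<le> N" using N by simp
      then have "\<not> has_occurrence N p"
        using occurrence_avoiding_doubled[OF p _ p3' p12] has_occurrence * by (blast elim: has_occurrenceE)
      moreover have "p 1 \<le> N - 2" using p12 p2 j by auto
      ultimately show "\<not> has_occurrence N p \<and> p 1 \<le> N - 2" by blast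
    qed
  qed
  moreover have "{p \<in> centrosymmetric_perms N. p 2 = j \<and> \<not> has_occurrence N p \<and> p 1 \<le> N - 2}
      = {p \<in> avoiders N. p 1 \<le> N - 2 \<and> p 2 = j}" unfolding avoiders_def by blast
  moreover have "{p' \<in> centrosymmetric_perms M. \<not> has_occurrence M p' \<and> p' 1 \<le> M - 2 \<and> p' 2 = h}
      = {p' \<in> avoiders M. p' 1 \<le> M - 2 \<and> p' 2 = h}" unfolding avoiders_def by blast
  ultimately show ?thesis unfolding h_def by simp
qed

lemma card_by_value:
  assumes "finite S" "finite J"
  shows "card {p \<in> S. f p \<in> J} = (\<Sum>j\<in>J. card {p \<in> S. f p = j})"
proof -
  have "{p \<in> S. f p \<in> J} = (\<Union>j\<in>J. {p \<in> S. f p = j})" by blast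
  then show ?thesis using card_UN_disjoint[of J "\<lambda>j. {p \<in> S. f p = j}"] assms by auto
qed

text \<open>
  Sums the preceding bijections over the value \<open>j\<close> of the second entry. No permutation has
  \<open>j = n\<close>: the third entry would be \<open>n + 1\<close>, which is also the entry at position \<open>N - 1\<close>.
\<close>

lemma card_both_small:
  assumes N: "N = M + 2" "N = 2 * n" "3 \<le> n"
  shows "card {p \<in> avoiders N. p 1 \<le> N - 2 \<and> p 2 \<le> N - 2}
       = card {p' \<in> avoiders M. p' 1 \<le> M - 2 \<and> p' 2 \<le> M - 1}"
proof -
  define F where "F j = card {p \<in> {p \<in> avoiders N. p 1 \<le> N - 2}. p 2 = j}" for j
  define F' where "F' j = card {p' \<in> {p' \<in> avoiders M. p' 1 \<le> M - 2}. p' 2 = j}" for j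
  define h where "h j = (if j < n then j else j - 1)" for j
  have FF': "F j = F' (h j)" if "j \<in> {1..N - 2} - {n}" for j
    using card_fixed_second[OF N, of j] that unfolding F_def F'_def h_def by simp
  have Fn: "F n = 0"
  proof -
    have False if p: "p \<in> avoiders N" and p1: "p 1 \<le> N - 2" and p2: "p 2 = n" for p
    proof -
      have cs: "p \<in> centrosymmetric_perms N" using p by (simp add: avoiders_def)
      have "p 3 = n + 1" using third_is_second_plus_one[OF p p1] p2 N by simp
      moreover have "p (N - 1) = n + 1" using perm_mirror[OF cs, of 2] p2 N by simp
      ultimately have "p 3 = p (N - 1)" by simp
      then show False using N by (simp add: perm_inj[OF cs])
    qed
    then have "{p \<in> {p \<in> avoiders N. p 1 \<le> N - 2}. p 2 = n} = {}" by blast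
    then show ?thesis unfolding F_def by (simp only: card.empty)
  qed
  have bij: "bij_betw h ({1..N - 2} - {n}) {1..M - 1}"
  proof (rule bij_betw_byWitness[where f' = "\<lambda>u. if u < n then u else u + 1"])
    show "\<forall>a\<in>{1..N - 2} - {n}. (if h a < n then h a else h a + 1) = a" by (auto simp: h_def)
    show "\<forall>u\<in>{1..M - 1}. h (if u < n then u else u + 1) = u" by (auto simp: h_def)
    show "h ` ({1..N - 2} - {n}) \<subseteq> {1..M - 1}" using N by (auto simp: h_def)
    show "(\<lambda>u. if u < n then u else u + 1) ` {1..M - 1} \<subseteq> {1..N - 2} - {n}"
      using N by (auto simp: h_def)
  qed
  have "{p \<in> avoiders N. p 1 \<le> N - 2 \<and> p 2 \<le> N - 2}
      = {p \<in> {p \<in> avoiders N. p 1 \<le> N - 2}. p 2 \<in> {1..N - 2}}"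
    using perm_range[of _ N 2] N by (auto simp: avoiders_def)
  then have "card {p \<in> avoiders N. p 1 \<le> N - 2 \<and> p 2 \<le> N - 2} = sum F {1..N - 2}"
    unfolding F_def using card_by_value[of "{p \<in> avoiders N. p 1 \<le> N - 2}" "{1..N - 2}" "\<lambda>p. p 2"]
    by (simp add: finite_avoiders)
  also have "\<dots> = sum F ({1..N - 2} - {n})"
    using Fn by (intro sum.mono_neutral_right) auto
  also have "\<dots> = (\<Sum>j\<in>{1..N - 2} - {n}. F' (h j))" using FF' by (rule sum.cong[OF refl])
  also have "\<dots> = sum F' {1..M - 1}" by (rule sum.reindex_bij_betw[OF bij])
  also have "\<dots> = card {p' \<in> {p' \<in> avoiders M. p' 1 \<le> M - 2}. p' 2 \<in> {1..M - 1}}"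
    unfolding F'_def using card_by_value[of "{p' \<in> avoiders M. p' 1 \<le> M - 2}" "{1..M - 1}" "\<lambda>p. p 2"]
    by (simp add: finite_avoiders)
  also have "{p' \<in> {p' \<in> avoiders M. p' 1 \<le> M - 2}. p' 2 \<in> {1..M - 1}}
      = {p' \<in> avoiders M. p' 1 \<le> M - 2 \<and> p' 2 \<le> M - 1}"
    using perm_range[of _ M 2] N by (auto simp: avoiders_def)
  finally show ?thesis .
qed

section \<open>The even case\<close>

lemma card_split_top:
  fixes f :: "'a \<Rightarrow> nat"
  assumes "finite S" "2 \<le> N" "\<And>p. p \<in> S \<Longrightarrow> f p \<le> N"
  shows "card S = card {p \<in> S. f p = N} + card {p \<in> S. f p = N - 1} + card {p \<in> S. f p \<le> N - 2}"
proof -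
  have "S = {p \<in> S. f p = N} \<union> {p \<in> S. f p = N - 1} \<union> {p \<in> S. f p \<le> N - 2}"
    using assms(2,3) by force
  also have "card \<dots> = card ({p \<in> S. f p = N} \<union> {p \<in> S. f p = N - 1}) + card {p \<in> S. f p \<le> N - 2}"
    using assms by (intro card_Un_disjoint) auto
  also have "card ({p \<in> S. f p = N} \<union> {p \<in> S. f p = N - 1})
      = card {p \<in> S. f p = N} + card {p \<in> S. f p = N - 1}"
    using assms by (intro card_Un_disjoint) auto
  finally show ?thesis .
qed

lemma avoider_le: "p \<in> avoiders N \<Longrightarrow> i \<in> {1..N} \<Longrightarrow> p i \<le> N"
  using perm_range[of p N i] by (simp add: avoiders_def)

lemma id_avoider: "id \<in> avoiders N"
  by (auto simp: avoiders_def centrosymmetric_perms_def permutes_id has_occurrence_def occurrence_def)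

lemma card_avoiders_0: "card (avoiders 0) = 1"
proof -
  have "avoiders 0 = {id}"
    using id_avoider[of 0] by (auto simp: avoiders_def centrosymmetric_perms_def)
  then show ?thesis by simp
qed

lemma card_first_small:
  assumes "N = M + 2" "even N"
  shows "card (avoiders N) = 2 * card (avoiders M) + card {p \<in> avoiders N. p 1 \<le> N - 2}"
  using card_split_top[OF finite_avoiders, of N N "\<lambda>p. p 1"] avoider_le[of _ N 1] assms
    card_first_large[OF assms, of N] card_first_large[OF assms, of "N - 1"] by simp

lemma card_first_not_max:
  assumes "N = M + 2" "even N"
  shows "card {p \<in> avoiders N. p 1 \<noteq> N} + card (avoiders M) = card (avoiders N)"
proof -
  have "avoiders N = {p \<in> avoiders N. p 1 = N} \<union> {p \<in> avoiders N. p 1 \<noteq> N}" by blast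
  then have "card (avoiders N) = card {p \<in> avoiders N. p 1 = N} + card {p \<in> avoiders N. p 1 \<noteq> N}"
    using card_Un_disjoint[of "{p \<in> avoiders N. p 1 = N}" "{p \<in> avoiders N. p 1 \<noteq> N}"]
      finite_avoiders[of N] by (simp add: disjoint_iff)
  then show ?thesis using card_first_large[OF assms, of N] by simp
qed

lemma card_second_small:
  assumes N: "N = M + 2" "even N" "2 \<le> M"
  shows "card {p \<in> avoiders N. p 1 \<le> N - 2} =
     2 * card {p \<in> avoiders M. p 1 \<noteq> M} + card {p \<in> avoiders N. p 1 \<le> N - 2 \<and> p 2 \<le> N - 2}"
proof -
  have "finite {p \<in> avoiders N. p 1 \<le> N - 2}" using finite_avoiders by simp
  from card_split_top[OF this, of N "\<lambda>p. p 2"]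
  show ?thesis using avoider_le[of _ N 2] N
      card_second_large[OF N, of N] card_second_large[OF N, of "N - 1"] by simp
qed

text \<open>
  Of the permutations of length \<open>2n + 6\<close> in question, deletion leads to those of length \<open>2n + 4\<close>
  covered by the induction hypothesis and to those whose second entry is the second largest
  value; the latter number \<open>c\<^bsub>n+1\<^esub> - c\<^sub>n\<close>, with \<open>c\<^sub>n\<close> the number of avoiders of length \<open>2n\<close>, so
  the sum telescopes.
\<close>

lemma card_both_small_eq:
  "card {p \<in> avoiders (2 * n + 4). p 1 \<le> 2 * n + 2 \<and> p 2 \<le> 2 * n + 2} = card (avoiders (2 * n))"
proof (induction n)
  case 0
  have "p = id" if p: "p \<in> avoiders 4" "p 1 \<le> 2" "p 2 \<le> 2" for p
  proof -
    have cs: "p \<in> centrosymmetric_perms 4" using p by (simp add: avoiders_def)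
    have "p 1 < p 2" using first_less_second[OF p(1)] p by simp
    moreover have "1 \<le> p 1" using perm_range[OF cs, of 1] by simp
    ultimately have "p 1 = 1" "p 2 = 2" using p by linarith+
    moreover have "p 3 = 3" "p 4 = 4"
      using perm_mirror[OF cs, of 1] perm_mirror[OF cs, of 2] calculation by simp_all
    moreover have "i \<notin> {1..4} \<or> i = 1 \<or> i = 2 \<or> i = 3 \<or> i = 4" for i :: nat by auto
    ultimately have "p i = id i" for i using perm_outside[OF cs, of i] by (metis id_apply)
    then show ?thesis by blast
  qed
  then have single: "{p \<in> avoiders 4. p 1 \<le> 2 \<and> p 2 \<le> 2} = {id}" using id_avoider[of 4] by auto
  show ?case
    by (simp only: mult_0_right add_0 single card_avoiders_0) simp
next
  case (Suc n)
  define N where "N = 2 * n + 6"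
  define M where "M = 2 * n + 4"
  have N: "N = M + 2" "N = 2 * (n + 3)" "3 \<le> n + 3" by (auto simp: N_def M_def)
  have M: "M = (2 * n + 2) + 2" "even M" "2 \<le> 2 * n + 2" by (auto simp: M_def)
  have M': "2 * n + 2 = 2 * n + 2" "even (2 * n + 2)" by auto
  have "card {p \<in> avoiders N. p 1 \<le> N - 2 \<and> p 2 \<le> N - 2}
      = card {p \<in> avoiders M. p 1 \<le> M - 2 \<and> p 2 \<le> M - 1}" by (rule card_both_small[OF N])
  also have "{p \<in> avoiders M. p 1 \<le> M - 2 \<and> p 2 \<le> M - 1}
      = {p \<in> avoiders M. p 1 \<le> M - 2 \<and> p 2 = M - 1} \<union>
        {p \<in> avoiders M. p 1 \<le> M - 2 \<and> p 2 \<le> M - 2}" using M(1) by auto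
  also have "card \<dots> = card {p \<in> avoiders M. p 1 \<le> M - 2 \<and> p 2 = M - 1} +
        card {p \<in> avoiders M. p 1 \<le> M - 2 \<and> p 2 \<le> M - 2}"
    using finite_avoiders[of M] M(1) by (intro card_Un_disjoint) auto
  also have "\<dots> = card {p \<in> avoiders (2 * n + 2). p 1 \<noteq> 2 * n + 2} + card (avoiders (2 * n))"
    using card_second_large[OF M, of "M - 1"] Suc by (simp add: M_def)
  also have "\<dots> = card (avoiders (2 * n + 2))" by (rule card_first_not_max[OF M'])
  finally have "card {p \<in> avoiders N. p 1 \<le> N - 2 \<and> p 2 \<le> N - 2} = card (avoiders (2 * n + 2))" .
  moreover have "2 * Suc n + 4 = N" "2 * Suc n + 2 = N - 2" "2 * Suc n = 2 * n + 2"
    by (simp_all add: N_def)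
  ultimately show ?case by (simp only:)
qed

lemma card_avoiders_rec:
  "card (avoiders (2 * n + 4)) + card (avoiders (2 * n)) = 4 * card (avoiders (2 * n + 2))"
proof -
  have N: "2 * n + 4 = (2 * n + 2) + 2" "even (2 * n + 4)" "2 \<le> 2 * n + 2" by auto
  have M: "2 * n + 2 = 2 * n + 2" "even (2 * n + 2)" by auto
  show ?thesis
    using card_first_small[OF N(1,2)] card_second_small[OF N] card_first_not_max[OF M]
      card_both_small_eq[of n] by simp
qed

lemma card_avoiders_2: "card (avoiders 2) = 2"
proof -
  have "p \<notin> avoiders 2 \<or> \<not> p 1 \<le> 2 - 2" for p
    using perm_range[of p 2 1] by (auto simp: avoiders_def)
  then have none: "{p \<in> avoiders 2. p 1 \<le> 2 - 2} = {}" by blast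
  show ?thesis using card_first_small[of 2 0, unfolded none] card_avoiders_0 by simp
qed

section \<open>The odd case\<close>

text \<open>
  Every point different from the centre and its image lie in opposite quadrants around the
  centre. If the centre is one of the small entries, both large entries lie above and to the
  right of it, and their images serve as the two small entries. If it is one of the two large
  entries, the other large entry lies in the upper left or in the lower right quadrant; its image
  replaces the centre unless one of the small entries gets in the way, and then the image
  of that small entry replaces the centre.
\<close>

lemma occurrence_avoiding_centre:
  assumes p: "p \<in> centrosymmetric_perms (2 * n + 1)" and b: "occurrence (2 * n + 1) p i j k l"
  shows "\<exists>i j k l. occurrence (2 * n + 1) p i j k l \<and> i \<noteq> n + 1 \<and> j \<noteq> n + 1 \<and> k \<noteq> n + 1 \<and> l \<noteq> n + 1"
proof -
  define c where "c = n + 1"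
  define r where "r x = 2 * c - x" for x
  have ix: "1 \<le> i" "i < j" "j < k" "k < l" "l < 2 * c" and v: "p i < p l" "p j < p l" "p l < p k"
    using b unfolding occurrence_def c_def by auto
  have pr: "p (r x) = 2 * c - p x" "1 \<le> p x" "p x < 2 * c" if "1 \<le> x" "x < 2 * c" for x
    using perm_mirror[OF p, of x] perm_range[OF p, of x] that by (auto simp: c_def r_def)
  have pc: "p c = c"
    using pr(1)[of c] pr(3)[of c] by (auto simp: r_def c_def)
  have ri: "r i = 2 * c - i" and rj: "r j = 2 * c - j" and rk: "r k = 2 * c - k" and rl: "r l = 2 * c - l"
    by (simp_all add: r_def)
  have pi: "p (r i) = 2 * c - p i" "1 \<le> p i" "p i < 2 * c"
    and pj: "p (r j) = 2 * c - p j" "1 \<le> p j" "p j < 2 * c"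
    and pk: "p (r k) = 2 * c - p k" "1 \<le> p k" "p k < 2 * c"
    and pl: "p (r l) = 2 * c - p l" "1 \<le> p l" "p l < 2 * c"
    using pr[of i] pr[of j] pr[of k] pr[of l] ix by auto
  let ?goal = "\<exists>i j k l. 1 \<le> i \<and> i < j \<and> j < k \<and> k < l \<and> l < 2 * c \<and> p i < p l \<and> p j < p l \<and> p l < p k
      \<and> i \<noteq> c \<and> j \<noteq> c \<and> k \<noteq> c \<and> l \<noteq> c"
  consider "i = c \<or> j = c" | "k = c" | "l = c" | "i \<noteq> c" "j \<noteq> c" "k \<noteq> c" "l \<noteq> c" by blast
  then have ?goal
  proof cases
    case 1
    then have "c < k" "c < p l" using ix v pc by auto
    then have "1 \<le> r l" "r l < r k" "r k < k" "k < l" "l < 2 * c"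
      "p (r l) < p l" "p (r k) < p l" "p l < p k" "r l \<noteq> c" "r k \<noteq> c" "k \<noteq> c" "l \<noteq> c"
      using ix v pk pl rk rl by auto
    then show ?thesis by blast
  next
    case 2
    then have lt: "c < l" "p l < c" "j < c" using ix v pc by auto
    show ?thesis
    proof (cases "j < r l")
      case True
      then have "1 \<le> i" "i < j" "j < r l" "r l < l" "l < 2 * c"
        "p i < p l" "p j < p l" "p l < p (r l)" "i \<noteq> c" "j \<noteq> c" "r l \<noteq> c" "l \<noteq> c"
        using ix v lt pl rl by auto
      then show ?thesis by blast
    next
      case False
      have "j \<noteq> r l" using pl v lt by auto
      then have "1 \<le> i" "i < j" "j < r j" "r j < l" "l < 2 * c"
        "p i < p l" "p j < p l" "p l < p (r j)" "i \<noteq> c" "j \<noteq> c" "r j \<noteq> c" "l \<noteq> c"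
        using False ix v lt pj rj rl by auto
      then show ?thesis by blast
    qed
  next
    case 3
    then have lt: "k < c" "c < p k" "p i < c" "p j < c" using ix v pc by auto
    have ne: "i \<noteq> r k" "j \<noteq> r k" using ix lt rk by auto
    then have ne': "p i \<noteq> p (r k)" "p j \<noteq> p (r k)" by (simp_all add: perm_inj[OF p])
    have ixs: "1 \<le> i" "i < j" "j < k" "i \<noteq> c" "j \<noteq> c" "k \<noteq> c"
      using ix lt by auto
    show ?thesis
    proof (cases "p i < p (r k) \<and> p j < p (r k)")
      case True
      then have "k < r k" "r k < 2 * c" "p (r k) < p k" "r k \<noteq> c" using lt ix pk rk by auto
      then show ?thesis using True ixs by blast
    next
      case False
      then obtain a where a: "a = i \<or> a = j" "p (r k) < p a" using ne' by fastforce
      then have "p (r a) = 2 * c - p a" "r a = 2 * c - a" "a < k" "1 \<le> a" "p a < c"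
        using pi(1) pj(1) ix lt r_def by auto
      then have "k < r a" "r a < 2 * c" "r a \<noteq> c" "p i < p (r a)" "p j < p (r a)" "p (r a) < p k"
        using a(2) lt pk by linarith+
      then show ?thesis using ixs by blast
    qed
  next
    case 4
    then show ?thesis using ix v by blast
  qed
  then show ?thesis unfolding occurrence_def c_def
    by (elim exE) (intro exI, auto)
qed

lemma card_avoiders_odd: "card (avoiders (2 * n + 1)) = card (avoiders (2 * n))"
proof -
  define e where "e k = (if k \<le> n then k else k + 1)" for k :: nat
  have mono: "strict_mono_on {1..2 * n} e" by (rule strict_mono_onI) (auto simp: e_def)
  have img: "e ` {1..2 * n} = {1..2 * n + 1} - {n + 1}"
  proof -
    have "x \<in> e ` {1..2 * n}" if "x \<in> {1..2 * n + 1} - {n + 1}" for x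
    proof (rule image_eqI)
      show "x = e (if x \<le> n then x else x - 1)" using that by (auto simp: e_def)
      show "(if x \<le> n then x else x - 1) \<in> {1..2 * n}" using that by auto
    qed
    moreover have "e ` {1..2 * n} \<subseteq> {1..2 * n + 1} - {n + 1}" by (auto simp: e_def)
    ultimately show ?thesis by blast
  qed
  have img': "e ` {1..2 * n} = {1..2 * n + 1} - id ` {n + 1}" using img by simp
  have mirror: "e (2 * n + 1 - k) = 2 * n + 1 + 1 - e k" if "k \<in> {1..2 * n}" for k
    using that by (auto simp: e_def)
  have "card {p \<in> centrosymmetric_perms (2 * n + 1). (\<forall>a\<in>{n + 1}. p a = id a) \<and> \<not> has_occurrence (2 * n + 1) p}
      = card {p' \<in> centrosymmetric_perms (2 * n). \<not> has_occurrence (2 * n) p'}"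
  proof (rule card_extensions[OF mono img mono img' mirror mirror])
    fix p p' assume p: "p \<in> centrosymmetric_perms (2 * n + 1)"
      and p': "p' \<in> centrosymmetric_perms (2 * n)"
      and pe: "\<And>k. k \<in> {1..2 * n} \<Longrightarrow> p (e k) = e (p' k)"
    have "has_occurrence (2 * n) p' \<longleftrightarrow> (\<exists>i j k l. occurrence (2 * n + 1) p i j k l \<and>
        i \<notin> {n + 1} \<and> j \<notin> {n + 1} \<and> k \<notin> {n + 1} \<and> l \<notin> {n + 1})"
      by (rule has_occurrence_extension[OF mono img mono p' pe])
    also have "\<dots> \<longleftrightarrow> has_occurrence (2 * n + 1) p"
      using occurrence_avoiding_centre[OF p] by (blast intro: has_occurrenceI elim: has_occurrenceE)
    finally show "\<not> has_occurrence (2 * n + 1) p \<longleftrightarrow> \<not> has_occurrence (2 * n) p'" by simp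
  qed auto
  moreover have "p (n + 1) = n + 1" if "p \<in> centrosymmetric_perms (2 * n + 1)" for p
    using perm_mirror[OF that, of "n + 1"] perm_range[OF that, of "n + 1"] by auto
  then have "{p \<in> centrosymmetric_perms (2 * n + 1). (\<forall>a\<in>{n + 1}. p a = id a) \<and> \<not> has_occurrence (2 * n + 1) p}
      = avoiders (2 * n + 1)" unfolding avoiders_def by auto
  ultimately show ?thesis unfolding avoiders_def by simp
qed

theorem theorem3p14:
  fixes q :: "nat \<Rightarrow> int" and n :: nat
  assumes "q 1 = 2"
    and "q 2 = 7"
    and "\<And>k. k \<ge> 3 \<Longrightarrow> q k = 4 * q (k - 1) - q (k - 2)"
    and "n \<ge> 1"
  shows "card (centrosymmetric_avoiders (2 * n) {[1, 2, 4, 3], [2, 1, 4, 3]}) =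
           card (centrosymmetric_avoiders (2 * n + 1) {[1, 2, 4, 3], [2, 1, 4, 3]}) \<and>
         int (card (centrosymmetric_avoiders (2 * n + 1) {[1, 2, 4, 3], [2, 1, 4, 3]})) = q n"
proof -
  have "int (card (avoiders (2 * n))) = q n" using assms(4)
  proof (induction n rule: less_induct)
    case (less n)
    consider "n = 1" | "n = 2" | "3 \<le> n" using less.prems by linarith
    then show ?case
    proof cases
      case 1
      then show ?thesis using card_avoiders_2 assms(1) by simp
    next
      case 2
      have "card (avoiders 4) + card (avoiders 0) = 4 * card (avoiders 2)"
        using card_avoiders_rec[of 0] by (simp only: mult_0_right add_0)
      then show ?thesis using 2 card_avoiders_0 card_avoiders_2 assms(2) by simp
    next
      case 3
      define m where "m = n - 2"
      have m: "n = m + 2" "1 \<le> m" using 3 by (simp_all add: m_def)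
      have "int (card (avoiders (2 * (m + 1)))) = q (m + 1)" "int (card (avoiders (2 * m))) = q m"
        using less.IH[of "m + 1"] less.IH[of m] m by simp_all
      moreover have "q n = 4 * q (m + 1) - q m" using assms(3)[OF 3] m(1) by simp
      moreover have "2 * n = 2 * m + 4" "2 * (m + 1) = 2 * m + 2" using m(1) by simp_all
      ultimately show ?thesis using card_avoiders_rec[of m] by simp
    qed
  qed
  then show ?thesis unfolding centrosymmetric_avoiders_eq using card_avoiders_odd[of n] by simp
qed

end
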